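(* Let $p\in(0,1)$ be fixed. With high probability, $$ \mathrm{sat}\left(G\left(n,p\right),C_4\right)\leqslant \frac{3(1+(1-p)^3)}{2(1-(1-p)^3)}n(1+o(1)) $$ when $p>1-1/\sqrt[3]{7}$, and $$ \mathrm{sat}\left(G\left(n,p\right),C_4\right)\leqslant \left(\frac{s+1}{2}+s(1-p)^s+\frac{s(1-p)^{2s}}{1-(1-p)^s}\right)n(1+o(1)) $$ when $p\leqslant1-1/\sqrt[3]{7}$, where $s$ is the minimum positive integer such that $(2s^2+1)(1-p)^s < 1$.
   Context: $G(n,p)$ is the binomial random graph on vertex set $[n]$ in which each pair of vertices is adjacent independently with probability $p$. A property holds with high probability if its probability tends to $1$ as $n\to\infty$; $o(1)$ denotes a function of $n$ tending to $0$. $C_4$ is the cycle on $4$ vertices. For graphs $F,G$, a spanning subgraph $H\subseteq G$ is $F$-saturated in $G$ if $H$ contains no copy of $F$ but adding to $H$ any edge of $G$ not in $H$ creates a copy of $F$; $\mathrm{sat}(G,F)$ is the minimum number of edges of an $F$-saturated graph in $G$. *)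

theory Defs
  imports "HOL-Probability.Probability"
begin

text \<open>Simple graphs on the vertex set [n] = {0..<n} are represented by their edge
  sets, edges being 2-element subsets of vertices.\<close>

definition all_edges :: "nat \<Rightarrow> nat set set" where
  "all_edges n = {{i, j} | i j. i < j \<and> j < n}"

definition Gnp :: "nat \<Rightarrow> real \<Rightarrow> nat set set pmf" where
  "Gnp n p = map_pmf (\<lambda>f. {e \<in> all_edges n. f e})
              (Pi_pmf (all_edges n) False (\<lambda>_. bernoulli_pmf p))"

definition has_C4 :: "nat set set \<Rightarrow> bool" where
  "has_C4 H \<longleftrightarrow> (\<exists>a b c d. distinct [a, b, c, d] \<and>
      {a, b} \<in> H \<and> {b, c} \<in> H \<and> {c, d} \<in> H \<and> {d, a} \<in> H)"

definition C4_saturated_in :: "nat set set \<Rightarrow> nat set set \<Rightarrow> bool" where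
  "C4_saturated_in H G \<longleftrightarrow> H \<subseteq> G \<and> \<not> has_C4 H \<and> (\<forall>e \<in> G - H. has_C4 (insert e H))"

definition sat_C4 :: "nat set set \<Rightarrow> nat" where
  "sat_C4 G = (LEAST m. \<exists>H. C4_saturated_in H G \<and> card H = m)"

end

theory Submission
  imports Defs "HOL-Real_Asymp.Real_Asymp"
begin

text \<open>
  Choose hubs v 0, v 1, ..., v (m - 1) in G such that v 0 is adjacent to all the others, v 1 is
  adjacent to v 2, and every remaining vertex is adjacent to some hub. Start from the C4-free graph
  that consists of the star from v 0 to the other hubs, the edge between v 1 and v 2, and one edge
  from each remaining vertex x to its first neighbouring hub v (lev x), and extend it to a
  C4-saturated subgraph H of G in an arbitrary way. No matter how this is done, H is sparse: two
  neighbours of z in the same level i together with v i would close a 4-cycle, so z has at most one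
  neighbour in each level (unless z = v i), and adjacent hubs have no edges at all between their levels.
  Hence, up to O(m^2), H has at most 3n/2 edges plus lev y - 1 further ones for each y with lev y at
  least 3.

  With high probability any j fixed vertices of G(n,p) have about q^j n common non-neighbours. This
  controls the first K levels, and a greedy choice of O(log n) further hubs among the neighbours of
  v 0 finishes the domination at a cost of a small multiple of n. The total is
  (3/2 + q^3 + q^3/p + o(1)) n, and this constant is strictly smaller than the one in the theorem
  in both ranges of p, so that the error term in the theorem can be taken to be 0.
\<close>

section \<open>Common non-neighbours in the random graph\<close>

text \<open>Members of \<open>T\<close> are not removed: for \<open>G\<close> inside
  \<open>all_edges n\<close> the singleton \<open>{t, t}\<close> is no edge, so \<open>t\<close> is
  counted whenever it is non-adjacent to the rest of \<open>T\<close>.\<close>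

definition common_nonnbrs :: "nat \<Rightarrow> nat set set \<Rightarrow> nat set \<Rightarrow> nat set" where
  "common_nonnbrs n G T = {x \<in> {..<n}. \<forall>t\<in>T. {x, t} \<notin> G}"

lemma finite_common_nonnbrs [simp]: "finite (common_nonnbrs n G T)"
  by (simp add: common_nonnbrs_def)

lemma finite_all_edges [simp]: "finite (all_edges n)"
  by (rule finite_subset[of _ "Pow {..<n}"]) (auto simp: all_edges_def)

lemma all_edges_iff: "{x, y} \<in> all_edges n \<longleftrightarrow> x < n \<and> y < n \<and> x \<noteq> y"
proof
  assume "{x, y} \<in> all_edges n"
  then show "x < n \<and> y < n \<and> x \<noteq> y"
    by (auto simp: all_edges_def doubleton_eq_iff)
next
  assume "x < n \<and> y < n \<and> x \<noteq> y"
  then show "{x, y} \<in> all_edges n"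
    unfolding all_edges_def mem_Collect_eq by (metis insert_commute linorder_neqE_nat)
qed

text \<open>Different vertices \<open>x\<close> outside \<open>T\<close> look at disjoint sets of
  pairs \<open>{x, t}\<close>: an overlap \<open>{x, t} = {y, u}\<close> with \<open>x\<close> and
  \<open>y\<close> distinct would force \<open>x = u\<close>, which lies in
  \<open>T\<close>.\<close>

lemma indep_vars_no_nbr_in:
  assumes T: "T \<subseteq> {..<n}"
  shows "prob_space.indep_vars (measure_pmf (Pi_pmf (all_edges n) False (\<lambda>_. bernoulli_pmf p)))
           (\<lambda>_. borel) (\<lambda>x f. of_bool (\<forall>t\<in>T. \<not> f {x, t}) :: real) ({..<n} - T)"
proof -
  let ?M = "Pi_pmf (all_edges n) False (\<lambda>_. bernoulli_pmf p)"
  define E where "E = (\<lambda>x. (\<lambda>t. {x, t}) ` T)"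
  have finT: "finite T" using T finite_subset by blast
  have sub: "E x \<subseteq> all_edges n" if "x \<in> {..<n} - T" for x
    using that T by (auto simp: E_def all_edges_iff)
  have disj: "disjoint_family_on E ({..<n} - T)"
    by (auto simp: disjoint_family_on_def E_def doubleton_eq_iff)
  have 1: "prob_space.indep_vars (measure_pmf ?M) (\<lambda>x. PiM (E x) (\<lambda>_. count_space UNIV))
          (\<lambda>x f. restrict (\<lambda>e. f e) (E x)) ({..<n} - T)"
    by (rule prob_space.indep_vars_restrict[OF measure_pmf.prob_space_axioms indep_vars_Pi_pmf])
      (use sub disj in auto)
  have 2: "prob_space.indep_vars (measure_pmf ?M) (\<lambda>_. borel)
          (\<lambda>x f. (\<lambda>g. of_bool (\<forall>t\<in>T. \<not> g {x, t}) :: real) (restrict (\<lambda>e. f e) (E x))) ({..<n} - T)"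
  proof (rule prob_space.indep_vars_compose2[OF measure_pmf.prob_space_axioms 1])
    fix x
    have [measurable]: "(\<lambda>g. g {x, t}) \<in> PiM (E x) (\<lambda>_. count_space UNIV) \<rightarrow>\<^sub>M count_space (UNIV :: bool set)"
      if "t \<in> T" for t
      using that by (intro measurable_component_singleton) (auto simp: E_def)
    show "(\<lambda>g. of_bool (\<forall>t\<in>T. \<not> g {x, t}) :: real) \<in>
            PiM (E x) (\<lambda>_. count_space UNIV) \<rightarrow>\<^sub>M borel"
      using finT by measurable
  qed
  show ?thesis
    using 2 by (auto simp: E_def cong: ball_cong)
qed

lemma expectation_no_nbr_in:
  assumes T: "T \<subseteq> {..<n}" and x: "x \<in> {..<n} - T" and p: "0 \<le> p" "p \<le> 1"
  shows "measure_pmf.expectation (Pi_pmf (all_edges n) False (\<lambda>_. bernoulli_pmf p))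
           (\<lambda>f. of_bool (\<forall>t\<in>T. \<not> f {x, t}) :: real) = (1 - p) ^ card T"
proof -
  let ?M = "Pi_pmf (all_edges n) False (\<lambda>_. bernoulli_pmf p)"
  have finT: "finite T" using T finite_subset by blast
  define E where "E = (\<lambda>t. {x, t}) ` T"
  have sub: "E \<subseteq> all_edges n"
    using x T by (auto simp: E_def all_edges_iff)
  have cE: "card E = card T"
    unfolding E_def by (rule card_image) (auto simp: inj_on_def doubleton_eq_iff)
  have "measure_pmf.expectation ?M (\<lambda>f. of_bool (\<forall>t\<in>T. \<not> f {x, t}) :: real)
     = measure_pmf.expectation ?M (indicator {f. \<forall>t\<in>T. \<not> f {x, t}})"
    by (intro arg_cong[where f = "measure_pmf.expectation ?M"]) (auto simp: indicator_def)
  also have "\<dots> = measure_pmf.prob ?M {f. \<forall>t\<in>T. \<not> f {x, t}}"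
    by simp
  \<comment> \<open>Written as a product set, with a constraint only at the \<open>card T\<close>
    pairs of \<open>E\<close>, the event has a probability that factors over the edges.\<close>
  also have "{f. \<forall>t\<in>T. \<not> f {x, t}} = Pi (all_edges n) (\<lambda>e. if e \<in> E then {False} else UNIV)"
  proof -
    have "(\<forall>t\<in>T. \<not> f {x, t}) \<longleftrightarrow> (\<forall>e\<in>all_edges n. e \<in> E \<longrightarrow> \<not> f e)" for f
      using sub unfolding E_def by blast
    moreover have "f \<in> Pi (all_edges n) (\<lambda>e. if e \<in> E then {False} else UNIV) \<longleftrightarrow>
        (\<forall>e\<in>all_edges n. e \<in> E \<longrightarrow> \<not> f e)" for f
      unfolding Pi_iff by (intro ball_cong refl) simp
    ultimately show ?thesis by (intro set_eqI) (simp only: mem_Collect_eq)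
  qed
  also have "measure_pmf.prob ?M \<dots> =
     (\<Prod>e\<in>all_edges n. measure_pmf.prob (bernoulli_pmf p) (if e \<in> E then {False} else UNIV))"
    by (rule measure_Pi_pmf_Pi) simp
  also have "\<dots> = (\<Prod>e\<in>all_edges n. if e \<in> E then 1 - p else 1)"
    using p by (intro prod.cong) (auto simp: measure_pmf_single)
  also have "\<dots> = (1 - p) ^ card E"
    using sub by (simp add: prod.If_cases Int_absorb1)
  finally show ?thesis by (simp add: cE)
qed

text \<open>Hoeffding's inequality for the independent indicators of the vertices outside
  \<open>T\<close>. Half of the allowed deviation is reserved for the vertices of \<open>T\<close>
  themselves.\<close>

lemma prob_card_common_nonnbrs_deviation:
  assumes T: "T \<subseteq> {..<n}" "card T < n" "real (card T) \<le> \<delta> / 2 * real n"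
    and p: "0 \<le> p" "p \<le> 1" and \<delta>: "\<delta> > 0"
  shows "measure_pmf.prob (Gnp n p)
           {G. \<bar>real (card (common_nonnbrs n G T)) - (1 - p) ^ card T * real n\<bar> > \<delta> * real n}
         \<le> 2 * exp (- (\<delta>\<^sup>2 / 2) * real n)"
proof -
  let ?M = "Pi_pmf (all_edges n) False (\<lambda>_. bernoulli_pmf p)"
  let ?I = "{..<n} - T"
  define X where "X = (\<lambda>x f. of_bool (\<forall>t\<in>T. \<not> f {x, t}) :: real)"
  define \<mu> where "\<mu> = (\<Sum>x\<in>?I. measure_pmf.expectation ?M (X x))"
  have finT: "finite T" using T finite_subset by blast
  interpret Hoeffding_ineq "measure_pmf ?M" ?I X "\<lambda>_. 0" "\<lambda>_. 1" \<mu>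
    using indep_vars_no_nbr_in[OF T(1), of p]
    by unfold_locales (auto simp: X_def \<mu>_def)
  have cI: "card ?I = n - card T"
    using T by (simp add: card_Diff_subset finT)
  have \<mu>: "\<mu> = real (n - card T) * (1 - p) ^ card T"
    using T expectation_no_nbr_in[OF T(1) _ p] by (simp add: \<mu>_def X_def cI)
  have bd: "\<bar>(\<Sum>x\<in>?I. X x f) - \<mu>\<bar> \<ge> \<delta> / 2 * real n"
    if "\<bar>real (card (common_nonnbrs n {e \<in> all_edges n. f e} T)) - (1 - p) ^ card T * real n\<bar> > \<delta> * real n"
    for f
  proof -
    let ?N = "common_nonnbrs n {e \<in> all_edges n. f e} T"
    have "(\<Sum>x\<in>?I. X x f) = real (card {x\<in>?I. \<forall>t\<in>T. \<not> f {x, t}})"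
      by (simp add: X_def Int_def)
    also have "{x\<in>?I. \<forall>t\<in>T. \<not> f {x, t}} = ?N - T"
      using T by (auto simp: common_nonnbrs_def all_edges_iff)
    finally have S: "(\<Sum>x\<in>?I. X x f) = real (card (?N - T))" .
    have "card ?N \<le> card (?N - T) + card T"
      by (metis card_Un_le Un_Diff_cancel2 card_mono finite_UnI finite_common_nonnbrs finT Un_upper1 finite_Diff order_trans)
    moreover have "card (?N - T) \<le> card ?N" by (simp add: card_mono)
    ultimately have a: "real (card ?N) \<le> (\<Sum>x\<in>?I. X x f) + real (card T)" "(\<Sum>x\<in>?I. X x f) \<le> real (card ?N)"
      unfolding S by linarith+
    have m: "\<mu> = (1 - p) ^ card T * real n - real (card T) * (1 - p) ^ card T"
      using T(2) by (simp add: \<mu> algebra_simps)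
    have "0 \<le> real (card T) * (1 - p) ^ card T" "real (card T) * (1 - p) ^ card T \<le> real (card T)"
      using p by (auto intro!: mult_left_le power_le_one)
    \<comment> \<open>The count exceeds the sum by between 0 and \<open>card T\<close>, and the
      target exceeds \<open>\<mu>\<close> by between 0 and \<open>card T\<close>, so passing from
      one deviation to the other costs at most \<open>card T\<close>.\<close>
    with a m that T(3) show ?thesis by linarith
  qed
  have "measure_pmf.prob (Gnp n p)
           {G. \<bar>real (card (common_nonnbrs n G T)) - (1 - p) ^ card T * real n\<bar> > \<delta> * real n}
     = measure_pmf.prob ?M {f. \<bar>real (card (common_nonnbrs n {e \<in> all_edges n. f e} T)) - (1 - p) ^ card T * real n\<bar> > \<delta> * real n}"
    by (simp add: Gnp_def vimage_def)
  also have "\<dots> \<le> measure_pmf.prob ?M {f \<in> space (measure_pmf ?M). \<bar>(\<Sum>x\<in>?I. X x f) - \<mu>\<bar> \<ge> \<delta> / 2 * real n}"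
    by (intro measure_pmf.finite_measure_mono) (use bd in auto)
  also have "\<dots> \<le> 2 * exp (- 2 * (\<delta> / 2 * real n)\<^sup>2 / (\<Sum>x\<in>?I. (1 - 0)\<^sup>2))"
    using T(2) \<delta> by (intro Hoeffding_ineq_abs_ge) (auto simp: cI of_nat_diff)
  \<comment> \<open>Enlarging the number of summands to \<open>n\<close> weakens the bound slightly
    but makes it uniform in \<open>T\<close>.\<close>
  also have "- 2 * (\<delta> / 2 * real n)\<^sup>2 / (\<Sum>x\<in>?I. (1 - 0)\<^sup>2) \<le> - (\<delta>\<^sup>2 / 2) * real n"
  proof -
    have "- 2 * (\<delta> / 2 * real n)\<^sup>2 / real (n - card T) \<le> - 2 * (\<delta> / 2 * real n)\<^sup>2 / real n"
      using T(2) by (intro divide_left_mono_neg) auto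
    also have "\<dots> = - (\<delta>\<^sup>2 / 2) * real n"
      by (simp add: power2_eq_square field_simps)
    finally show ?thesis by (simp add: cI)
  qed
  finally show ?thesis by simp
qed

text \<open>This deterministic property is the only information about the random graph that the rest
  of the proof uses.\<close>

definition equidistributed :: "nat \<Rightarrow> real \<Rightarrow> nat \<Rightarrow> real \<Rightarrow> nat set set \<Rightarrow> bool" where
  "equidistributed n q K \<delta> G \<longleftrightarrow> G \<subseteq> all_edges n \<and>
     (\<forall>T \<subseteq> {..<n}. card T \<le> K \<longrightarrow>
        \<bar>real (card (common_nonnbrs n G T)) - q ^ card T * real n\<bar> \<le> \<delta> * real n)"

text \<open>A union bound: there are polynomially many sets \<open>T\<close>, and each fails with
  exponentially small probability.\<close>

lemma Gnp_equidistributed_tendsto_1: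
  assumes p: "0 \<le> p" "p \<le> 1" and \<delta>: "\<delta> > 0"
  shows "(\<lambda>n. measure_pmf.prob (Gnp n p) {G. equidistributed n (1 - p) K \<delta> G}) \<longlonglongrightarrow> 1"
proof (rule tendsto_sandwich)
  define F where "F = (\<lambda>n::nat. 1 - (\<Sum>i\<le>K. real n ^ i) * (2 * exp (- (\<delta>\<^sup>2 / 2) * real n)))"
  have "(\<lambda>n::nat. real n ^ i * (2 * exp (- (\<delta>\<^sup>2 / 2) * real n))) \<longlonglongrightarrow> 0" for i
    using \<delta> by real_asymp
  then have "(\<lambda>n. 1 - (\<Sum>i\<le>K. real n ^ i * (2 * exp (- (\<delta>\<^sup>2 / 2) * real n)))) \<longlonglongrightarrow> 1 - (\<Sum>i\<le>K. 0)"
    by (intro tendsto_intros)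
  then show "F \<longlonglongrightarrow> 1"
    by (simp add: F_def sum_distrib_right)
  have ev: "eventually (\<lambda>n. real K \<le> \<delta> / 2 * real n \<and> n > K) sequentially"
  proof (rule eventually_conj)
    show "eventually (\<lambda>n. real K \<le> \<delta> / 2 * real n) sequentially"
      using \<delta> by real_asymp
  qed (rule eventually_gt_at_top)
  show "eventually (\<lambda>n. F n \<le> measure_pmf.prob (Gnp n p) {G. equidistributed n (1 - p) K \<delta> G}) sequentially"
    using ev
  proof eventually_elim
    case (elim n)
    define B where "B = (\<lambda>T. {G. \<bar>real (card (common_nonnbrs n G T)) - (1 - p) ^ card T * real n\<bar> > \<delta> * real n})"
    define TT where "TT = {T. T \<subseteq> {..<n} \<and> card T \<le> K}"
    \<comment> \<open>Covering the small sets by lists of length at most \<open>K\<close> gives the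
      polynomial count \<open>\<Sum>i\<le>K. n ^ i\<close>.\<close>
    have TT: "TT \<subseteq> set ` {xs. set xs \<subseteq> {..<n} \<and> length xs \<le> K}"
    proof
      fix T assume "T \<in> TT"
      moreover then have "finite T" by (auto simp: TT_def intro: finite_subset)
      then obtain xs where "set xs = T" "distinct xs" using finite_distinct_list by blast
      ultimately show "T \<in> set ` {xs. set xs \<subseteq> {..<n} \<and> length xs \<le> K}"
        by (intro image_eqI[of _ _ xs]) (auto simp: TT_def distinct_card)
    qed
    have finL: "finite {xs. set xs \<subseteq> {..<n} \<and> length xs \<le> K}"
      by (rule finite_lists_length_le) simp
    have finTT: "finite TT" using TT finL by (meson finite_imageI finite_subset)
    have "card TT \<le> card {xs. set xs \<subseteq> {..<n} \<and> length xs \<le> K}"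
      using TT finL by (meson card_image_le card_mono finite_imageI order_trans)
    also have "\<dots> = (\<Sum>i\<le>K. n ^ i)"
      by (simp add: card_lists_length_le)
    finally have cTT: "real (card TT) \<le> (\<Sum>i\<le>K. real n ^ i)"
      by (metis (mono_tags, lifting) of_nat_le_iff of_nat_power of_nat_sum sum.cong)
    \<comment> \<open>Restricting to the support is what guarantees
      \<open>G \<subseteq> all_edges n\<close>, so only the deviation events in \<open>B\<close>
      remain.\<close>
    have "- {G. equidistributed n (1 - p) K \<delta> G} \<inter> set_pmf (Gnp n p) \<subseteq> (\<Union>T\<in>TT. B T)"
      by (auto simp: equidistributed_def TT_def B_def Gnp_def not_le)
    then have "measure_pmf.prob (Gnp n p) (- {G. equidistributed n (1 - p) K \<delta> G}) \<le> measure_pmf.prob (Gnp n p) (\<Union>T\<in>TT. B T)"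
      by (metis measure_Int_set_pmf measure_pmf.finite_measure_mono sets_measure_pmf UNIV_I sets_UNIV)
    also have "\<dots> \<le> (\<Sum>T\<in>TT. measure_pmf.prob (Gnp n p) (B T))"
      by (rule measure_pmf.finite_measure_subadditive_finite) (use finTT in auto)
    also have "\<dots> \<le> (\<Sum>T\<in>TT. 2 * exp (- (\<delta>\<^sup>2 / 2) * real n))"
    proof (rule sum_mono)
      fix T assume "T \<in> TT"
      then show "measure_pmf.prob (Gnp n p) (B T) \<le> 2 * exp (- (\<delta>\<^sup>2 / 2) * real n)"
        unfolding B_def using elim p \<delta> by (intro prob_card_common_nonnbrs_deviation) (auto simp: TT_def)
    qed
    also have "\<dots> = real (card TT) * (2 * exp (- (\<delta>\<^sup>2 / 2) * real n))"
      by simp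
    also have "\<dots> \<le> (\<Sum>i\<le>K. real n ^ i) * (2 * exp (- (\<delta>\<^sup>2 / 2) * real n))"
      using cTT by (intro mult_right_mono) auto
    finally show ?case
      unfolding F_def using measure_pmf.prob_compl[of "{G. equidistributed n (1 - p) K \<delta> G}" "Gnp n p"]
      by (simp add: Compl_eq_Diff_UNIV)
  qed
  show "eventually (\<lambda>n. measure_pmf.prob (Gnp n p) {G. equidistributed n (1 - p) K \<delta> G} \<le> 1) sequentially"
    by simp
qed simp

section \<open>Saturated extensions of a hub system\<close>

text \<open>Take an inclusion-maximal C4-free graph between \<open>H0\<close> and \<open>G\<close>;
  maximality is exactly the saturation condition.\<close>

lemma ex_saturated_extension:
  assumes "finite G" "H0 \<subseteq> G" "\<not> has_C4 H0"
  shows "\<exists>H. H0 \<subseteq> H \<and> C4_saturated_in H G"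
proof -
  define A where "A = {H. H0 \<subseteq> H \<and> H \<subseteq> G \<and> \<not> has_C4 H}"
  have "finite A" by (rule finite_subset[of _ "Pow G"]) (use assms in \<open>auto simp: A_def\<close>)
  moreover have "H0 \<in> A" using assms by (auto simp: A_def)
  ultimately have "\<exists>H\<in>A. \<forall>H'\<in>A. H \<subseteq> H' \<longrightarrow> H = H'"
    by (intro finite_has_maximal) auto
  then obtain H where H: "H \<in> A" "\<And>H'. H' \<in> A \<Longrightarrow> H \<subseteq> H' \<Longrightarrow> H = H'" by blast
  have "has_C4 (insert e H)" if e: "e \<in> G - H" for e
  proof (rule ccontr)
    assume "\<not> has_C4 (insert e H)"
    then have "insert e H \<in> A" using H(1) e by (auto simp: A_def)
    from H(2)[OF this] e show False by blast
  qed
  with H(1) show ?thesis unfolding A_def C4_saturated_in_def by blast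
qed

lemma has_C4I:
  "{a, b} \<in> H \<Longrightarrow> {b, c} \<in> H \<Longrightarrow> {c, d} \<in> H \<Longrightarrow> {d, a} \<in> H \<Longrightarrow> distinct [a, b, c, d] \<Longrightarrow> has_C4 H"
  unfolding has_C4_def by blast

section \<open>Hub systems and the base graph\<close>

locale hub_system =
  fixes n :: nat and G :: "nat set set" and m :: nat and v :: "nat \<Rightarrow> nat"
  assumes G_sub: "G \<subseteq> all_edges n"
    and m_ge_3: "3 \<le> m"
    and v0_adj: "\<And>i. 0 < i \<Longrightarrow> i < m \<Longrightarrow> {v 0, v i} \<in> G"
    and v1_v2_adj: "{v 1, v 2} \<in> G"
    and dominating: "\<And>x. x < n \<Longrightarrow> x \<notin> v ` {..<m} \<Longrightarrow> \<exists>i<m. {x, v i} \<in> G"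
begin

definition hubs :: "nat set" where "hubs = v ` {..<m}"
definition nonhubs :: "nat set" where "nonhubs = {..<n} - hubs"
text \<open>Because the first neighbouring hub is taken, a vertex of level at least \<open>j\<close>
  misses the first \<open>j\<close> hubs. This is how the sizes of the levels are controlled
  later.\<close>

definition lev :: "nat \<Rightarrow> nat" where "lev x = (LEAST i. {x, v i} \<in> G)"
text \<open>The edge between \<open>v 1\<close> and \<open>v 2\<close> serves to forbid edges
  between levels 1 and 2, so that level 2 adds nothing to the count of upward edges.\<close>

definition base :: "nat set set" where
  "base = (\<lambda>i. {v 0, v i}) ` {0<..<m} \<union> {{v 1, v 2}} \<union> (\<lambda>x. {x, v (lev x)}) ` nonhubs"

lemma finite_G: "finite G"
  using G_sub finite_all_edges by (rule finite_subset)

lemma finite_nonhubs [simp]: "finite nonhubs" by (simp add: nonhubs_def)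
lemma finite_hubs [simp]: "finite hubs" by (simp add: hubs_def)
lemma card_hubs: "card hubs \<le> m"
  unfolding hubs_def using card_image_le[of "{..<m}" v] by simp

lemma edge_distinct: "{x, y} \<in> G \<Longrightarrow> x \<noteq> y"
  using G_sub all_edges_iff by blast

lemma lev_props:
  assumes "x \<in> nonhubs"
  shows "lev x < m" "{x, v (lev x)} \<in> G" "v (lev x) \<in> hubs"
proof -
  obtain i where i: "i < m" "{x, v i} \<in> G"
    using assms dominating by (auto simp: nonhubs_def hubs_def)
  show "{x, v (lev x)} \<in> G" unfolding lev_def by (rule LeastI) (rule i)
  have "lev x \<le> i" unfolding lev_def by (rule Least_le) (rule i)
  then show "lev x < m" using i by simp
  then show "v (lev x) \<in> hubs" by (simp add: hubs_def)
qed

lemma nonhub_neq_hub: "x \<in> nonhubs \<Longrightarrow> y \<in> nonhubs \<Longrightarrow> x \<noteq> v (lev y)"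
  using lev_props(3) unfolding nonhubs_def by blast

lemma base_subset: "base \<subseteq> G"
  using v0_adj v1_v2_adj lev_props by (auto simp: base_def)

lemma base_star: "0 < i \<Longrightarrow> i < m \<Longrightarrow> {v 0, v i} \<in> base"
  by (auto simp: base_def)

lemma base_pendant: "x \<in> nonhubs \<Longrightarrow> {x, v (lev x)} \<in> base"
  by (auto simp: base_def)

text \<open>A non-hub has only one neighbour in \<open>base\<close>, so a 4-cycle would consist of
  hubs. At most two of its edges meet \<open>v 0\<close>, and the other two would both have to be
  the edge between \<open>v 1\<close> and \<open>v 2\<close>.\<close>

lemma base_not_C4: "\<not> has_C4 base"
proof
  assume "has_C4 base"
  then obtain a b c d where d: "distinct [a, b, c, d]"
    and e: "{a, b} \<in> base" "{b, c} \<in> base" "{c, d} \<in> base" "{d, a} \<in> base"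
    by (auto simp: has_C4_def)
  have hubI: "v 0 \<in> hubs" "v 1 \<in> hubs" "v 2 \<in> hubs" using m_ge_3 by (auto simp: hubs_def)
  have pend: "y = v (lev x)" if "x \<notin> hubs" "{x, y} \<in> base" for x y
    using that hubI lev_props by (auto simp: base_def doubleton_eq_iff hubs_def)
  have hubI2: "x \<in> hubs" if "{y, x} \<in> base" "{x, z} \<in> base" "y \<noteq> z" for x y z
    using pend that by (metis insert_commute)
  have hub: "a \<in> hubs" "b \<in> hubs" "c \<in> hubs" "d \<in> hubs"
    using hubI2[OF e(4,1)] hubI2[OF e(1,2)] hubI2[OF e(2,3)] hubI2[OF e(3,4)] d by simp_all
  have core: "x = v 0 \<or> y = v 0 \<or> x = v 1 \<and> y = v 2 \<or> x = v 2 \<and> y = v 1"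
    if "x \<in> hubs" "y \<in> hubs" "{x, y} \<in> base" for x y
  proof -
    have "{x, y} \<noteq> {z, v (lev z)}" if "z \<in> nonhubs" for z
      using that \<open>x \<in> hubs\<close> \<open>y \<in> hubs\<close> by (auto simp: doubleton_eq_iff nonhubs_def)
    then have "{x, y} = {v 1, v 2} \<or> (\<exists>i. {x, y} = {v 0, v i})"
      using \<open>{x, y} \<in> base\<close> unfolding base_def by blast
    then show ?thesis unfolding doubleton_eq_iff by metis
  qed
  show False
    using core[OF hub(1,2) e(1)] core[OF hub(2,3) e(2)] core[OF hub(3,4) e(3)] core[OF hub(4,1) e(4)] d
    by (elim disjE conjE; simp)
qed

section \<open>Edge count of a C4-free graph between \<open>base\<close> and
  \<open>G\<close>\<close>

context
  fixes H assumes HG: "H \<subseteq> G" and bH: "base \<subseteq> H" and nC4: "\<not> has_C4 H"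
begin

text \<open>Otherwise \<open>z\<close>, \<open>x\<close>, the hub of the level and \<open>y\<close>
  form a 4-cycle. The vertex \<open>z\<close> may itself be a hub of another level, which is the
  case needed for \<open>card_stray\<close>.\<close>

lemma unique_nbr_in_level:
  assumes "x \<in> nonhubs" "y \<in> nonhubs" "lev x = lev y" "z \<noteq> v (lev y)" "{z, x} \<in> H" "{z, y} \<in> H"
  shows "x = y"
proof (rule ccontr)
  assume "x \<noteq> y"
  let ?h = "v (lev y)"
  have h: "{x, ?h} \<in> H" "{y, ?h} \<in> H" using base_pendant assms bH by (metis subsetD)+
  have "has_C4 H"
  proof (rule has_C4I[of z x _ ?h y])
    show "{?h, y} \<in> H" "{y, z} \<in> H" using h assms by (simp_all add: insert_commute)
    have "?h \<in> hubs" using lev_props assms by blast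
    then show "distinct [z, x, ?h, y]"
      using assms \<open>x \<noteq> y\<close> HG edge_distinct[of z x] edge_distinct[of z y] by (auto simp: nonhubs_def)
  qed (use h assms in auto)
  then show False using nC4 by simp
qed

lemma unique_nonhub_nbr_in_level:
  assumes "x \<in> nonhubs" "y \<in> nonhubs" "z \<in> nonhubs" "lev x = lev y" "{z, x} \<in> H" "{z, y} \<in> H"
  shows "x = y"
  using assms unique_nbr_in_level nonhub_neq_hub by blast

text \<open>The edge would close the 4-cycle through \<open>x\<close>, its hub, the hub of
  \<open>y\<close>, and \<open>y\<close>.\<close>

lemma no_edge_between_adjacent_hubs:
  assumes "x \<in> nonhubs" "y \<in> nonhubs" "{v (lev x), v (lev y)} \<in> H" "x \<noteq> y"
  shows "{x, y} \<notin> H"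
proof
  assume xy: "{x, y} \<in> H"
  have "has_C4 H"
  proof (rule has_C4I[of x "v (lev x)" _ "v (lev y)" y])
    show "{v (lev y), y} \<in> H" using base_pendant assms bH by (metis subsetD insert_commute)
    show "{x, v (lev x)} \<in> H" using base_pendant assms bH by (metis subsetD)
    show "{y, x} \<in> H" using xy by (simp add: insert_commute)
    have "v (lev x) \<noteq> v (lev y)" using assms HG edge_distinct by blast
    then show "distinct [x, v (lev x), v (lev y), y]"
      using assms(4) nonhub_neq_hub[OF assms(1,1)] nonhub_neq_hub[OF assms(1,2)]
        nonhub_neq_hub[OF assms(2,1)] nonhub_neq_hub[OF assms(2,2)] by auto
  qed (use assms in auto)
  then show False using nC4 by simp
qed

text \<open>Edges are stored as oriented pairs so that each class can be counted by an injection: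
  into a coordinate here, and into a vertex together with a level for \<open>upward\<close> and
  \<open>stray\<close>.\<close>

definition lateral :: "(nat \<times> nat) set" where
  "lateral = {(x, y). x \<in> nonhubs \<and> y \<in> nonhubs \<and> lev x = lev y \<and> x < y \<and> {x, y} \<in> H}"
definition upward :: "(nat \<times> nat) set" where
  "upward = {(x, y). x \<in> nonhubs \<and> y \<in> nonhubs \<and> lev x < lev y \<and> {x, y} \<in> H}"
definition stray :: "(nat \<times> nat) set" where
  "stray = {(h, x). h \<in> hubs \<and> x \<in> nonhubs \<and> h \<noteq> v (lev x) \<and> {h, x} \<in> H}"

text \<open>The lateral edges form a matching: both projections are injective, and a vertex in both
  images would have two neighbours in its own level.\<close>

lemma card_lateral: "2 * card lateral \<le> n"
proof -
  have fin: "finite lateral" by (rule finite_subset[of _ "nonhubs \<times> nonhubs"]) (auto simp: lateral_def)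
  have sw: "{x, y} \<in> H \<Longrightarrow> {y, x} \<in> H" for x y by (simp add: insert_commute)
  have "inj_on fst lateral"
  proof (rule inj_onI, clarify)
    fix a b c d assume "(a, b) \<in> lateral" "(c, d) \<in> lateral" "fst (a, b) = fst (c, d)"
    then show "a = c \<and> b = d"
      using unique_nonhub_nbr_in_level[of b d a] by (simp add: lateral_def)
  qed
  then have 1: "card (fst ` lateral) = card lateral" by (rule card_image)
  have "inj_on snd lateral"
  proof (rule inj_onI, clarify)
    fix a b c d assume "(a, b) \<in> lateral" "(c, d) \<in> lateral" "snd (a, b) = snd (c, d)"
    then show "a = c \<and> b = d"
      using unique_nonhub_nbr_in_level[of a c b] sw by (simp add: lateral_def)
  qed
  then have 2: "card (snd ` lateral) = card lateral" by (rule card_image)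
  have "fst ` lateral \<inter> snd ` lateral = {}"
  proof (rule ccontr)
    assume "fst ` lateral \<inter> snd ` lateral \<noteq> {}"
    then obtain x y z where xy: "(x, y) \<in> lateral" "(z, x) \<in> lateral" by auto
    then have "y = z"
      using unique_nonhub_nbr_in_level[of y z x] sw by (simp add: lateral_def)
    with xy show False by (auto simp: lateral_def)
  qed
  then have "card lateral + card lateral = card (fst ` lateral \<union> snd ` lateral)"
    using fin 1 2 by (simp add: card_Un_disjoint)
  also have "\<dots> \<le> card {..<n}"
    by (rule card_mono) (auto simp: lateral_def nonhubs_def)
  finally show ?thesis by simp
qed

text \<open>A hub that is not the hub of a given level has at most one neighbour there, so hub and
  level determine the edge.\<close>

lemma card_stray: "card stray \<le> m * m"
proof -
  have "inj_on (\<lambda>(h, x). (h, lev x)) stray"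
  proof (rule inj_onI, clarsimp)
    fix a b d assume "(a, b) \<in> stray" "(a, d) \<in> stray" "lev b = lev d"
    then show "b = d"
      using unique_nbr_in_level[of b d a] by (simp add: stray_def)
  qed
  then have "card stray = card ((\<lambda>(h, x). (h, lev x)) ` stray)" by (simp add: card_image)
  also have "\<dots> \<le> card (hubs \<times> {..<m})"
    by (rule card_mono) (auto simp: stray_def lev_props)
  also have "\<dots> \<le> m * m" using card_hubs by simp
  finally show ?thesis .
qed

text \<open>The upper end \<open>y\<close> and the level of the lower end determine the edge. Level
  0 is excluded because \<open>v 0\<close> is joined to all other hubs, and the pair of levels 1 and
  2 because of the edge between \<open>v 1\<close> and \<open>v 2\<close>. This leaves
  \<open>lev y - 1\<close> possible levels, and none when \<open>lev y < 3\<close>.\<close>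

lemma card_upward: "card upward \<le> (\<Sum>y\<in>nonhubs. if lev y < 3 then 0 else lev y - 1)"
proof -
  let ?S = "\<lambda>y. if lev y < 3 then {} else {1..<lev y}"
  have "inj_on (\<lambda>(x, y). (y, lev x)) upward"
  proof (rule inj_onI, clarsimp)
    fix a b c assume "(a, b) \<in> upward" "(c, b) \<in> upward" "lev a = lev c"
    then show "a = c"
      using unique_nonhub_nbr_in_level[of a c b] by (simp add: upward_def insert_commute)
  qed
  then have "card upward = card ((\<lambda>(x, y). (y, lev x)) ` upward)" by (simp add: card_image)
  also have "\<dots> \<le> card (SIGMA y:nonhubs. ?S y)"
  proof (rule card_mono)
    show "(\<lambda>(x, y). (y, lev x)) ` upward \<subseteq> (SIGMA y:nonhubs. ?S y)"
    proof clarify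
      fix x y assume "(x, y) \<in> upward"
      then have xy: "x \<in> nonhubs" "y \<in> nonhubs" "lev x < lev y" "{x, y} \<in> H"
        by (auto simp: upward_def)
      have "{v (lev x), v (lev y)} \<notin> H" using no_edge_between_adjacent_hubs xy by blast
      moreover have "{v 0, v (lev y)} \<in> H"
        using base_star[of "lev y"] xy(3) lev_props(1)[OF xy(2)] bH by auto
      moreover have "{v 1, v 2} \<in> H" using bH by (auto simp: base_def)
      ultimately have "lev x \<noteq> 0" "\<not> (lev x = 1 \<and> lev y = 2)" by metis+
      then show "y \<in> nonhubs \<and> lev x \<in> ?S y" using xy by auto
    qed
  qed auto
  also have "\<dots> = (\<Sum>y\<in>nonhubs. card (?S y))" by simp
  also have "\<dots> = (\<Sum>y\<in>nonhubs. if lev y < 3 then 0 else lev y - 1)"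
    by (rule sum.cong) auto
  finally show ?thesis .
qed

text \<open>Hub-hub and stray edges contribute at most \<open>m * m\<close> each, pendant edges at
  most \<open>n\<close>, lateral edges at most half of \<open>n\<close>. Doubling avoids the
  fraction.\<close>

lemma card_C4_free: "2 * card H \<le> 3 * n + 4 * m\<^sup>2 + 2 * (\<Sum>y\<in>nonhubs. if lev y < 3 then 0 else lev y - 1)"
proof -
  let ?e = "\<lambda>(x, y). {x, y} :: nat set"
  have "H \<subseteq> ?e ` (hubs \<times> hubs) \<union> (\<lambda>x. {x, v (lev x)}) ` nonhubs \<union> ?e ` stray \<union> ?e ` lateral \<union> ?e ` upward"
    (is "_ \<subseteq> ?R")
  proof
    fix e assume e: "e \<in> H"
    then obtain x y where xy: "e = {x, y}" "x < n" "y < n" "x \<noteq> y"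
      using HG G_sub by (auto simp: all_edges_def)
    have sym: "e \<in> ?R" if *: "e = {x, y}" "x \<in> hubs" "y \<in> nonhubs" for x y
    proof (cases "x = v (lev y)")
      case True then show ?thesis using * by (auto simp: insert_commute)
    next
      case False
      then have "(x, y) \<in> stray" using * e by (auto simp: stray_def)
      then show ?thesis using * by (auto intro!: image_eqI[of _ ?e "(x, y)"])
    qed
    have both: "e \<in> ?R" if *: "e = {x, y}" "x \<in> nonhubs" "y \<in> nonhubs" "lev x < lev y \<or> lev x = lev y \<and> x < y" for x y
    proof -
      have "(x, y) \<in> lateral \<union> upward" using * e by (auto simp: lateral_def upward_def)
      then show ?thesis using * by (auto intro!: image_eqI[of _ ?e "(x, y)"])
    qed
    have e': "e = {y, x}" using xy by auto
    consider "x \<in> hubs" "y \<in> hubs" | "x \<in> hubs" "y \<in> nonhubs" | "y \<in> hubs" "x \<in> nonhubs" | "x \<in> nonhubs" "y \<in> nonhubs"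
      using xy by (auto simp: nonhubs_def)
    then show "e \<in> ?R"
    proof cases
      case 1 then show ?thesis using xy by (auto intro!: image_eqI[of _ ?e "(x, y)"])
    next
      case 2 then show ?thesis using sym xy by blast
    next
      case 3 then show ?thesis using sym e' by blast
    next
      case 4
      have "lev x < lev y \<or> lev x = lev y \<and> x < y \<or> lev y < lev x \<or> lev y = lev x \<and> y < x"
        using xy(4) by linarith
      then show ?thesis using both xy(1) e' 4 by blast
    qed
  qed
  moreover have fin: "finite lateral" "finite upward" "finite stray"
    by (rule finite_subset[of _ "(nonhubs \<union> hubs) \<times> nonhubs"];
        force simp: lateral_def upward_def stray_def)+
  ultimately have "card H \<le> card ?R" by (intro card_mono) auto
  also have "\<dots> \<le> card (?e ` (hubs \<times> hubs)) + card ((\<lambda>x. {x, v (lev x)}) ` nonhubs) + card (?e ` stray)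
      + card (?e ` lateral) + card (?e ` upward)"
    by (intro order_trans[OF card_Un_le] add_mono order_refl)
  also have "\<dots> \<le> card (hubs \<times> hubs) + card nonhubs + card stray + card lateral + card upward"
    using fin by (intro add_mono card_image_le) auto
  finally have 1: "card H \<le> card (hubs \<times> hubs) + card nonhubs + card stray + card lateral + card upward" .
  have "card (hubs \<times> hubs) \<le> m * m" using card_hubs by (simp add: mult_mono)
  moreover have "card nonhubs \<le> n"
    using card_mono[of "{..<n}" nonhubs] by (auto simp: nonhubs_def)
  ultimately show ?thesis using 1 card_stray card_lateral card_upward by (simp add: power2_eq_square)
qed

end

text \<open>Layer-cake summation: for \<open>lev y \<ge> 3\<close>, the value
  \<open>lev y - 1\<close> is 1 plus the number of \<open>j\<close> with
  \<open>3 \<le> j \<le> lev y\<close>, and the vertices of level at least \<open>j\<close> miss the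
  first \<open>j\<close> hubs.\<close>

lemma sum_lev_le:
  "(\<Sum>y\<in>nonhubs. if lev y < 3 then 0 else lev y - 1)
     \<le> card (common_nonnbrs n G (v ` {..<3})) + (\<Sum>j=3..<m. card (common_nonnbrs n G (v ` {..<j})))"
proof -
  let ?N = "\<lambda>j. {y \<in> nonhubs. j \<le> lev y}"
  have N: "card (?N j) \<le> card (common_nonnbrs n G (v ` {..<j}))" for j
  proof (rule card_mono)
    have "{y, v i} \<notin> G" if "i < lev y" for y i
      using that not_less_Least unfolding lev_def by blast
    then show "?N j \<subseteq> common_nonnbrs n G (v ` {..<j})"
      by (auto simp: common_nonnbrs_def nonhubs_def)
  qed simp
  have "(if lev y < 3 then 0 else lev y - 1) = of_bool (3 \<le> lev y) + (\<Sum>j=3..<m. of_bool (j \<le> lev y))"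
    if "y \<in> nonhubs" for y
  proof -
    have "{3..<m} \<inter> {j. j \<le> lev y} = {3..<Suc (lev y)}" using lev_props(1)[OF that] by auto
    then show ?thesis by auto
  qed
  then have "(\<Sum>y\<in>nonhubs. if lev y < 3 then 0 else lev y - 1)
     = (\<Sum>y\<in>nonhubs. of_bool (3 \<le> lev y)) + (\<Sum>j=3..<m. \<Sum>y\<in>nonhubs. of_bool (j \<le> lev y))"
    by (subst sum.swap) (simp add: sum.distrib cong: if_cong)
  also have "\<dots> = card (?N 3) + (\<Sum>j=3..<m. card (?N j))"
    by (simp add: Int_def)
  also have "\<dots> \<le> card (common_nonnbrs n G (v ` {..<3})) + (\<Sum>j=3..<m. card (common_nonnbrs n G (v ` {..<j})))"
    by (intro add_mono sum_mono N)
  finally show ?thesis .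
qed

theorem sat_C4_le:
  "2 * sat_C4 G \<le> 3 * n + 4 * m\<^sup>2 + 2 * (card (common_nonnbrs n G (v ` {..<3}))
     + (\<Sum>j=3..<m. card (common_nonnbrs n G (v ` {..<j}))))"
proof -
  obtain H where H: "base \<subseteq> H" "C4_saturated_in H G"
    using ex_saturated_extension[OF finite_G base_subset base_not_C4] by blast
  have "sat_C4 G \<le> card H"
    unfolding sat_C4_def using H by (intro Least_le) blast
  then have "2 * sat_C4 G \<le> 2 * card H" by simp
  also have "\<dots> \<le> 3 * n + 4 * m\<^sup>2 + 2 * (\<Sum>y\<in>nonhubs. if lev y < 3 then 0 else lev y - 1)"
    using H by (intro card_C4_free) (auto simp: C4_saturated_in_def)
  also have "\<dots> \<le> 3 * n + 4 * m\<^sup>2 + 2 * (card (common_nonnbrs n G (v ` {..<3}))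
     + (\<Sum>j=3..<m. card (common_nonnbrs n G (v ` {..<j}))))"
    by (intro add_left_mono mult_left_mono sum_lev_le) simp
  finally show ?thesis .
qed

end

section \<open>Choosing the hubs\<close>

text \<open>Double counting of the adjacent pairs between \<open>R\<close> and \<open>D\<close>:
  there are at least \<open>\<beta> * n * card R\<close> of them, and \<open>D\<close> has at most
  \<open>n\<close> vertices to share them.\<close>

lemma ex_vertex_covering_fraction:
  fixes \<beta> :: real
  assumes "R \<subseteq> {..<n}" "R \<noteq> {}" "D \<subseteq> {..<n}" "\<beta> > 0"
    and codeg: "\<And>x. x \<in> R \<Longrightarrow> \<beta> * real n \<le> real (card {w \<in> D. {x, w} \<in> G})"
  shows "\<exists>w\<in>D. \<beta> * real (card R) \<le> real (card {x \<in> R. {x, w} \<in> G})"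
proof (rule ccontr)
  assume "\<not> ?thesis"
  then have less: "real (card {x \<in> R. {x, w} \<in> G}) < \<beta> * real (card R)" if "w \<in> D" for w
    using that by force
  have fin: "finite R" "finite D" using assms finite_subset by blast+
  obtain x where x: "x \<in> R" using assms by blast
  then have n: "n > 0" using assms by auto
  with codeg[OF x] \<open>\<beta> > 0\<close> have "D \<noteq> {}"
    by (auto simp: mult_le_0_iff)
  have cD: "card D \<le> n" using card_mono[of "{..<n}" D] assms by simp
  have "real (card R) * (\<beta> * real n) = (\<Sum>x\<in>R. \<beta> * real n)" by simp
  also have "\<dots> \<le> (\<Sum>x\<in>R. real (card {w \<in> D. {x, w} \<in> G}))"
    by (intro sum_mono codeg)
  also have "\<dots> = (\<Sum>x\<in>R. \<Sum>w\<in>D. of_bool ({x, w} \<in> G))"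
    using fin by (simp add: Int_def)
  also have "\<dots> = (\<Sum>w\<in>D. \<Sum>x\<in>R. of_bool ({x, w} \<in> G))"
    by (rule sum.swap)
  also have "\<dots> = (\<Sum>w\<in>D. real (card {x \<in> R. {x, w} \<in> G}))"
    using fin by (simp add: Int_def)
  also have "\<dots> < (\<Sum>w\<in>D. \<beta> * real (card R))"
    using fin \<open>D \<noteq> {}\<close> less by (intro sum_strict_mono) auto
  also have "\<dots> = real (card D) * (\<beta> * real (card R))" by simp
  also have "\<dots> \<le> real n * (\<beta> * real (card R))"
    using cD \<open>\<beta> > 0\<close> by (intro mult_right_mono) auto
  finally show False by (simp add: mult_ac)
qed

lemma common_nonnbrs_insert:
  "common_nonnbrs n G (insert w T) = common_nonnbrs n G T - {x \<in> common_nonnbrs n G T. {x, w} \<in> G}"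
  by (auto simp: common_nonnbrs_def)

text \<open>Each new vertex shrinks the undominated set by the factor \<open>1 - \<beta>\<close>, so
  the sizes sum to at most a geometric series. The last clause makes the number of steps
  logarithmic: before the last step at least one vertex is left, and multiplying by
  \<open>1 - \<beta>\<close> avoids the exponent \<open>length ws - 1\<close>.\<close>

lemma ex_greedy_dominating:
  fixes \<beta> :: real
  assumes \<beta>: "0 < \<beta>" "\<beta> < 1" and D: "D \<subseteq> {..<n}"
    and codeg: "\<And>x. x \<in> common_nonnbrs n G T \<Longrightarrow> \<beta> * real n \<le> real (card {w \<in> D. {x, w} \<in> G})"
  shows "\<exists>ws. set ws \<subseteq> D \<and> common_nonnbrs n G (T \<union> set ws) = {} \<and>
    (\<Sum>j<length ws. real (card (common_nonnbrs n G (T \<union> set (take j ws)))))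
       \<le> real (card (common_nonnbrs n G T)) / \<beta> \<and>
    (ws = [] \<or> 1 - \<beta> \<le> (1 - \<beta>) ^ length ws * real (card (common_nonnbrs n G T)))"
  using codeg
proof (induction "card (common_nonnbrs n G T)" arbitrary: T rule: less_induct)
  case (less T)
  let ?R = "common_nonnbrs n G T"
  show ?case
  proof (cases "?R = {}")
    case True
    then show ?thesis by (intro exI[of _ "[]"]) auto
  next
    case False
    have "\<exists>w\<in>D. \<beta> * real (card ?R) \<le> real (card {x \<in> ?R. {x, w} \<in> G})"
      using False D \<beta> less.prems by (intro ex_vertex_covering_fraction[where n = n]) (auto simp: common_nonnbrs_def)
    then obtain w where w: "w \<in> D" "\<beta> * real (card ?R) \<le> real (card {x \<in> ?R. {x, w} \<in> G})"
      by blast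
    let ?R' = "common_nonnbrs n G (insert w T)"
    have pos: "card ?R > 0" using False by (simp add: card_gt_0_iff)
    have "card {x \<in> ?R. {x, w} \<in> G} \<le> card ?R" by (rule card_mono) auto
    then have "real (card ?R') = real (card ?R) - real (card {x \<in> ?R. {x, w} \<in> G})"
      unfolding common_nonnbrs_insert by (subst card_Diff_subset) auto
    with w have R': "real (card ?R') \<le> (1 - \<beta>) * real (card ?R)"
      by (simp add: algebra_simps)
    also have "\<dots> < real (card ?R)" using \<beta> pos by simp
    finally have "card ?R' < card ?R" by simp
    moreover have "\<beta> * real n \<le> real (card {w \<in> D. {x, w} \<in> G})" if "x \<in> ?R'" for x
      using that less.prems by (auto simp: common_nonnbrs_insert)
    ultimately obtain ws where ws: "set ws \<subseteq> D" "common_nonnbrs n G (insert w T \<union> set ws) = {}"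
      "(\<Sum>j<length ws. real (card (common_nonnbrs n G (insert w T \<union> set (take j ws))))) \<le> real (card ?R') / \<beta>"
      "ws = [] \<or> 1 - \<beta> \<le> (1 - \<beta>) ^ length ws * real (card ?R')"
      using less.hyps by blast
    have sum: "(\<Sum>j<length (w # ws). real (card (common_nonnbrs n G (T \<union> set (take j (w # ws))))))
       \<le> real (card ?R) / \<beta>"
    proof -
      have "(\<Sum>j<length (w # ws). real (card (common_nonnbrs n G (T \<union> set (take j (w # ws))))))
        = real (card ?R) + (\<Sum>j<length ws. real (card (common_nonnbrs n G (insert w T \<union> set (take j ws)))))"
        by (simp add: sum.lessThan_Suc_shift del: sum.lessThan_Suc)
      also have "\<dots> \<le> real (card ?R) + real (card ?R') / \<beta>" using ws by simp
      \<comment> \<open>The bound reproduces itself, since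
        \<open>1 + (1 - \<beta>) / \<beta> = 1 / \<beta>\<close>.\<close>
      also have "\<dots> \<le> real (card ?R) + (1 - \<beta>) * real (card ?R) / \<beta>"
        using R' \<beta> by (intro add_left_mono divide_right_mono) auto
      also have "\<dots> = real (card ?R) / \<beta>" using \<beta> by (simp add: field_simps)
      finally show ?thesis .
    qed
    have len: "1 - \<beta> \<le> (1 - \<beta>) ^ length (w # ws) * real (card ?R)"
    proof (cases "ws = []")
      case True
      have "(1 - \<beta>) * 1 \<le> (1 - \<beta>) * real (card ?R)" using \<beta> pos by (intro mult_left_mono) auto
      then show ?thesis using True by simp
    next
      case False
      then have "1 - \<beta> \<le> (1 - \<beta>) ^ length ws * real (card ?R')" using ws by blast
      also have "\<dots> \<le> (1 - \<beta>) ^ length ws * ((1 - \<beta>) * real (card ?R))"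
        using R' \<beta> by (intro mult_left_mono) auto
      finally show ?thesis by (simp add: mult_ac)
    qed
    show ?thesis
      using ws w sum len by (intro exI[of _ "w # ws"]) auto
  qed
qed

section \<open>Building a hub system in an equidistributed graph\<close>

lemma sum_power_atLeastLessThan:
  fixes q :: "'a :: comm_ring_1"
  assumes "m \<le> n"
  shows "(\<Sum>j=m..<n. q ^ j) * (1 - q) = q ^ m - q ^ n"
  using assms
proof (induction n rule: dec_induct)
  case (step n)
  have "(\<Sum>j=m..<Suc n. q ^ j) * (1 - q) = (\<Sum>j=m..<n. q ^ j) * (1 - q) + q ^ n * (1 - q)"
    using step.hyps by (simp add: distrib_right)
  also have "\<dots> = q ^ m - q ^ n + q ^ n * (1 - q)" by (simp only: step.IH)
  also have "\<dots> = q ^ m - q ^ Suc n" by (simp add: algebra_simps)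
  finally show ?case .
qed simp

text \<open>Inclusion-exclusion on the non-neighbourhoods gives density
  \<open>1 - 2 * (1 - p) + (1 - p)\<^sup>2 = p\<^sup>2\<close> with error at most
  \<open>3 * \<delta>\<close>, which is at most half of it.\<close>

lemma codegree_ge:
  assumes eq: "equidistributed n (1 - p) K \<delta> G" and K: "2 \<le> K" and \<delta>: "6 * \<delta> \<le> p\<^sup>2"
    and xy: "x < n" "y < n" "x \<noteq> y"
  shows "p\<^sup>2 / 2 * real n \<le> real (card {w \<in> {..<n}. {y, w} \<in> G \<and> {x, w} \<in> G})"
proof -
  let ?N = "common_nonnbrs n G" and ?C = "{w \<in> {..<n}. {y, w} \<in> G \<and> {x, w} \<in> G}"
  have dev: "\<bar>real (card (?N T)) - (1 - p) ^ card T * real n\<bar> \<le> \<delta> * real n" if "T \<subseteq> {..<n}" "card T \<le> K" for T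
    using eq that by (auto simp: equidistributed_def)
  have C: "?C = {..<n} - (?N {x} \<union> ?N {y})"
    by (auto simp: common_nonnbrs_def insert_commute)
  have I: "?N {x} \<inter> ?N {y} = ?N {x, y}" by (auto simp: common_nonnbrs_def)
  have sub: "?N {x} \<union> ?N {y} \<subseteq> {..<n}" by (auto simp: common_nonnbrs_def)
  have "card (?N {x}) + card (?N {y}) = card (?N {x} \<union> ?N {y}) + card (?N {x, y})"
    using card_Un_Int[of "?N {x}" "?N {y}"] by (simp add: I)
  moreover have "card (?N {x} \<union> ?N {y}) \<le> n" using card_mono[OF _ sub] by simp
  moreover have "card ?C = n - card (?N {x} \<union> ?N {y})"
    using sub unfolding C by (subst card_Diff_subset) auto
  ultimately have "real (card ?C) = real n - real (card (?N {x})) - real (card (?N {y})) + real (card (?N {x, y}))"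
    by linarith
  moreover have "real (card (?N {x})) \<le> (1 - p) * real n + \<delta> * real n"
    "real (card (?N {y})) \<le> (1 - p) * real n + \<delta> * real n"
    "(1 - p)\<^sup>2 * real n - \<delta> * real n \<le> real (card (?N {x, y}))"
    using dev[of "{x}"] dev[of "{y}"] dev[of "{x, y}"] xy K by (auto simp: abs_le_iff power2_eq_square)
  ultimately have "(p\<^sup>2 - 3 * \<delta>) * real n \<le> real (card ?C)"
    by (simp add: power2_eq_square algebra_simps)
  moreover have "p\<^sup>2 / 2 * real n \<le> (p\<^sup>2 - 3 * \<delta>) * real n"
    using \<delta> by (intro mult_right_mono) auto
  ultimately show ?thesis by linarith
qed

text \<open>Vertex 0 is the centre, \<open>b\<close> any neighbour of it, \<open>c\<close> a common
  neighbour of 0 and \<open>b\<close>, and \<open>us\<close> consists of further neighbours of 0.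
  The degree of 0 is bounded below by its codegree with vertex 1.\<close>

lemma ex_initial_hubs:
  assumes eq: "equidistributed n (1 - p) K \<delta> G" and K: "3 \<le> K" and \<delta>: "6 * \<delta> \<le> p\<^sup>2"
    and p: "0 < p" "p < 1" and n: "real K + 2 < p\<^sup>2 / 2 * real n"
  shows "\<exists>a b c us. length us = K - 3 \<and> distinct (a # b # c # us) \<and> {b, c} \<in> G \<and>
           (\<forall>u\<in>set (b # c # us). {a, u} \<in> G)"
proof -
  have G: "G \<subseteq> all_edges n" using eq by (simp add: equidistributed_def)
  have adj: "x < n" "y < n" "x \<noteq> y" if "{x, y} \<in> G" for x y
    using that G all_edges_iff by blast+
  have "p\<^sup>2 / 2 * real n \<le> real n * 1"
    using p power_le_one[of p 2] by (subst mult.commute) (intro mult_left_mono, auto)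
  then have n2: "n > 1" using n by linarith
  define D where "D = {w \<in> {..<n}. {0, w} \<in> G}"
  have "p\<^sup>2 / 2 * real n \<le> real (card {w \<in> {..<n}. {0, w} \<in> G \<and> {1, w} \<in> G})"
    using n2 K by (intro codegree_ge[OF eq _ \<delta>]) auto
  also have "\<dots> \<le> real (card D)"
    unfolding D_def of_nat_le_iff by (rule card_mono) auto
  finally have cD: "real K + 2 < real (card D)" using n by linarith
  then obtain b where b: "b \<in> D" by (cases "D = {}") auto
  then have bG: "{0, b} \<in> G" "b < n" "b \<noteq> 0" using adj[of 0 b] by (auto simp: D_def)
  have "p\<^sup>2 / 2 * real n \<le> real (card {w \<in> {..<n}. {0, w} \<in> G \<and> {b, w} \<in> G})"
    using n2 K bG by (intro codegree_ge[OF eq _ \<delta>]) auto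
  then have "0 < card {w \<in> {..<n}. {0, w} \<in> G \<and> {b, w} \<in> G}" using n by linarith
  then obtain c where c: "{0, c} \<in> G" "{b, c} \<in> G" "c \<in> D"
    unfolding D_def by (metis (no_types, lifting) card_gt_0_iff ex_in_conv mem_Collect_eq)
  have finD: "finite D" by (simp add: D_def)
  have "card (D - {b, c}) \<ge> card D - card {b, c}" by (rule diff_card_le_card_Diff) simp
  moreover have "card {b, c} \<le> 2" by (simp add: card_insert_if)
  ultimately have "K - 3 \<le> card (D - {b, c})" using cD by linarith
  then obtain S where S: "S \<subseteq> D - {b, c}" "card S = K - 3" "finite S"
    using obtain_subset_with_card_n by (metis finD finite_Diff finite_subset)
  obtain us where us: "set us = S" "distinct us" using S finite_distinct_list by blast
  have "length us = K - 3" using us S distinct_card by metis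
  moreover have "distinct (0 # b # c # us)"
    using us S bG c adj[of b c] adj[of 0 c] adj(3)[of 0] by (auto simp: D_def)
  moreover have "\<forall>u\<in>set (b # c # us). {0, u} \<in> G"
    using us S bG c by (auto simp: D_def)
  ultimately show ?thesis using c by blast
qed

text \<open>The first \<open>K\<close> hubs are controlled by equidistribution, which yields a
  geometric series; the \<open>l\<close> further hubs come from the greedy choice and cost at most
  \<open>(q ^ K + \<delta>) * n / \<beta>\<close>.\<close>

lemma sat_C4_le_of_equidistributed:
  assumes eq: "equidistributed n (1 - p) K \<delta> G" and K: "3 \<le> K" and \<delta>: "6 * \<delta> \<le> p\<^sup>2" "0 \<le> \<delta>"
    and p: "0 < p" "p < 1" and n: "real K + 2 < p\<^sup>2 / 2 * real n"
  defines "\<beta> \<equiv> p\<^sup>2 / 2" and "q \<equiv> 1 - p"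
  shows "\<exists>l. (l = 0 \<or> 1 - \<beta> \<le> (1 - \<beta>) ^ l * real n) \<and>
    real (sat_C4 G) \<le> (3 / 2 + q ^ 3 + q ^ 3 / p + q ^ K / \<beta> + (real K + 1 + 1 / \<beta>) * \<delta>) * real n
       + 2 * (real K + real l)\<^sup>2"
proof -
  let ?N = "common_nonnbrs n G"
  have q: "0 < q" "q < 1" using p by (auto simp: q_def)
  have "p\<^sup>2 \<le> 1" using p power_le_one[of p 2] by simp
  then have \<beta>: "0 < \<beta>" "\<beta> < 1" using p unfolding \<beta>_def by (simp, linarith)
  have G: "G \<subseteq> all_edges n" using eq by (simp add: equidistributed_def)
  have adj: "x < n" "y < n" "x \<noteq> y" if "{x, y} \<in> G" for x y
    using that G all_edges_iff by blast+
  have dev: "real (card (?N T)) \<le> (q ^ card T + \<delta>) * real n" if "T \<subseteq> {..<n}" "card T \<le> K" for T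
    using eq that unfolding equidistributed_def q_def by (smt (verit, best) distrib_right)
  obtain a b c us where us: "length us = K - 3" "distinct (a # b # c # us)" "{b, c} \<in> G"
      "\<forall>u\<in>set (b # c # us). {a, u} \<in> G"
    using ex_initial_hubs[OF eq K \<delta>(1) p n] by blast
  define vs where "vs = a # b # c # us"
  have lvs: "length vs = K" using us K by (simp add: vs_def)
  have dvs: "distinct vs" using us by (simp add: vs_def)
  have svs: "set vs \<subseteq> {..<n}" using us adj by (auto simp: vs_def)
  \<comment> \<open>Choosing the greedy hubs among the neighbours of \<open>a\<close> keeps the star
    condition of the hub system.\<close>
  define D where "D = {w \<in> {..<n}. {a, w} \<in> G}"
  have "\<exists>ws. set ws \<subseteq> D \<and> ?N (set vs \<union> set ws) = {} \<and>
    (\<Sum>j<length ws. real (card (?N (set vs \<union> set (take j ws))))) \<le> real (card (?N (set vs))) / \<beta> \<and>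
    (ws = [] \<or> 1 - \<beta> \<le> (1 - \<beta>) ^ length ws * real (card (?N (set vs))))"
  proof (rule ex_greedy_dominating[OF \<beta>])
    fix x assume x: "x \<in> ?N (set vs)"
    have "{a, b} \<in> G" using us by auto
    \<comment> \<open>Here \<open>x\<close> differs from \<open>a\<close> because \<open>a\<close>
      is adjacent to \<open>b\<close> while \<open>x\<close> is not.\<close>
    then have "x \<noteq> a" "x < n" "a < n" using x adj by (auto simp: common_nonnbrs_def vs_def)
    then have "\<beta> * real n \<le> real (card {w \<in> {..<n}. {a, w} \<in> G \<and> {x, w} \<in> G})"
      unfolding \<beta>_def using K by (intro codegree_ge[OF eq _ \<delta>(1)]) auto
    also have "{w \<in> {..<n}. {a, w} \<in> G \<and> {x, w} \<in> G} = {w \<in> D. {x, w} \<in> G}"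
      by (auto simp: D_def)
    finally show "\<beta> * real n \<le> real (card {w \<in> D. {x, w} \<in> G})" .
  qed (auto simp: D_def)
  then obtain ws where ws: "set ws \<subseteq> D" "?N (set vs \<union> set ws) = {}"
    "(\<Sum>j<length ws. real (card (?N (set vs \<union> set (take j ws))))) \<le> real (card (?N (set vs))) / \<beta>"
    "ws = [] \<or> 1 - \<beta> \<le> (1 - \<beta>) ^ length ws * real (card (?N (set vs)))"
    by blast
  define m where "m = K + length ws"
  define v where "v = (\<lambda>i. (vs @ ws) ! i)"
  have v: "v ` {..<j} = set (take j (vs @ ws))" if "j \<le> m" for j
    using nth_image[of j "vs @ ws"] that lvs by (simp add: v_def m_def lessThan_atLeast0)
  have v012: "v 0 = a" "v 1 = b" "v 2 = c" by (simp_all add: v_def vs_def)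
  interpret hub_system n G m v
  proof
    show "{v 0, v i} \<in> G" if "0 < i" "i < m" for i
    proof -
      define i' where "i' = i - 1"
      have i': "i = Suc i'" using that by (simp add: i'_def)
      have "v i = ((b # c # us) @ ws) ! i'" by (simp add: v_def vs_def i')
      moreover have "i' < length ((b # c # us) @ ws)" using that lvs by (simp add: m_def i' vs_def)
      ultimately have "v i \<in> set ((b # c # us) @ ws)" using nth_mem by metis
      then show ?thesis using us ws v012 by (auto simp: D_def)
    qed
    show "{v 1, v 2} \<in> G" using us v012 by simp
    show "\<exists>i<m. {x, v i} \<in> G" if "x < n" for x
    proof -
      have "x \<notin> ?N (v ` {..<m})" using ws(2) v[of m] lvs by (simp add: m_def)
      then show ?thesis using that by (auto simp: common_nonnbrs_def)
    qed
    show "3 \<le> m" using K by (simp add: m_def)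
  qed (rule G)
  have early: "real (card (?N (v ` {..<j}))) \<le> (q ^ j + \<delta>) * real n" if "j \<le> K" for j
  proof -
    have "v ` {..<j} = set (take j vs)" using v[of j] that lvs by (simp add: m_def)
    moreover have "card (set (take j vs)) = j" using dvs that lvs by (simp add: distinct_card)
    moreover have "set (take j vs) \<subseteq> {..<n}" using svs set_take_subset by fastforce
    ultimately show ?thesis using dev[of "set (take j vs)"] that by simp
  qed
  have late: "(\<Sum>j=K..<m. real (card (?N (v ` {..<j})))) \<le> (q ^ K + \<delta>) * real n / \<beta>"
  proof -
    have "(\<Sum>j=K..<m. real (card (?N (v ` {..<j})))) = (\<Sum>j<length ws. real (card (?N (v ` {..<j + K}))))"
      using sum.shift_bounds_nat_ivl[of "\<lambda>j. real (card (?N (v ` {..<j})))" 0 K "length ws"]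
      by (simp add: m_def lessThan_atLeast0 add.commute)
    also have "\<dots> = (\<Sum>j<length ws. real (card (?N (set vs \<union> set (take j ws)))))"
      by (intro sum.cong refl) (simp add: v lvs m_def)
    also have "\<dots> \<le> real (card (?N (set vs))) / \<beta>" by (rule ws)
    also have "\<dots> \<le> (q ^ K + \<delta>) * real n / \<beta>"
      using dev[OF svs] lvs dvs \<beta> by (intro divide_right_mono) (auto simp: distinct_card)
    finally show ?thesis .
  qed
  have "(\<Sum>j=3..<K. real (card (?N (v ` {..<j})))) \<le> (\<Sum>j=3..<K. (q ^ j + \<delta>) * real n)"
    by (intro sum_mono early) auto
  also have "\<dots> = ((\<Sum>j=3..<K. q ^ j) + real (K - 3) * \<delta>) * real n"
    by (simp add: sum.distrib flip: sum_distrib_right)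
  also have "\<dots> \<le> (q ^ 3 / p + real K * \<delta>) * real n"
  proof (intro mult_right_mono add_mono)
    have "(\<Sum>j=3..<K. q ^ j) * (1 - q) = q ^ 3 - q ^ K"
      using K by (rule sum_power_atLeastLessThan)
    then have "(\<Sum>j=3..<K. q ^ j) * p \<le> q ^ 3" using q by (simp add: q_def)
    then show "(\<Sum>j=3..<K. q ^ j) \<le> q ^ 3 / p" using p by (simp add: field_simps)
  qed (use \<delta> in auto)
  finally have mid: "(\<Sum>j=3..<K. real (card (?N (v ` {..<j})))) \<le> (q ^ 3 / p + real K * \<delta>) * real n" .
  have split: "(\<Sum>j=3..<m. real (card (?N (v ` {..<j})))) =
     (\<Sum>j=3..<K. real (card (?N (v ` {..<j})))) + (\<Sum>j=K..<m. real (card (?N (v ` {..<j}))))"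
    using K by (simp add: m_def sum.atLeastLessThan_concat)
  have "real (2 * sat_C4 G) \<le> real (3 * n + 4 * m\<^sup>2 + 2 * (card (?N (v ` {..<3}))
     + (\<Sum>j=3..<m. card (?N (v ` {..<j})))))"
    using sat_C4_le by (rule of_nat_mono)
  then have "2 * real (sat_C4 G) \<le> 3 * real n + 4 * (real m)\<^sup>2 + 2 * (real (card (?N (v ` {..<3})))
     + (\<Sum>j=3..<m. real (card (?N (v ` {..<j})))))"
    by simp
  then have "real (sat_C4 G) \<le> 3 / 2 * real n + 2 * (real m)\<^sup>2 + (q ^ 3 + \<delta>) * real n
     + (q ^ 3 / p + real K * \<delta>) * real n + (q ^ K + \<delta>) * real n / \<beta>"
  proof -
    let ?X = "(q ^ 3 + \<delta>) * real n + ((q ^ 3 / p + real K * \<delta>) * real n + (q ^ K + \<delta>) * real n / \<beta>)"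
    assume "2 * real (sat_C4 G) \<le> 3 * real n + 4 * (real m)\<^sup>2 + 2 * (real (card (?N (v ` {..<3})))
     + (\<Sum>j=3..<m. real (card (?N (v ` {..<j})))))"
    also have "\<dots> \<le> 3 * real n + 4 * (real m)\<^sup>2 + 2 * ?X"
      unfolding split using early[OF K] mid late by (intro add_left_mono mult_left_mono add_mono) auto
    finally show ?thesis by simp
  qed
  also have "\<dots> = (3 / 2 + q ^ 3 + q ^ 3 / p + q ^ K / \<beta> + (real K + 1 + 1 / \<beta>) * \<delta>) * real n
       + 2 * (real K + real (length ws))\<^sup>2"
    by (simp add: m_def algebra_simps add_divide_distrib)
  finally have "real (sat_C4 G) \<le> \<dots>" .
  moreover have "card (?N (set vs)) \<le> n"
    using card_mono[of "{..<n}" "?N (set vs)"] by (auto simp: common_nonnbrs_def)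
  then have "(1 - \<beta>) ^ length ws * real (card (?N (set vs))) \<le> (1 - \<beta>) ^ length ws * real n"
    using \<beta> by (intro mult_left_mono) auto
  then have "length ws = 0 \<or> 1 - \<beta> \<le> (1 - \<beta>) ^ length ws * real n"
    using ws(4) by force
  ultimately show ?thesis by blast
qed

section \<open>Comparison of the constants\<close>

text \<open>After subtracting 3/2 and cancelling \<open>q ^ 3\<close>, the claim is
  \<open>(2 - q) / (1 - q) < 3 / (1 - q ^ 3)\<close>, that is
  \<open>(2 - q) * (1 + q + q\<^sup>2) < 3\<close>.\<close>

lemma triangle_star_cost_less:
  fixes p :: real
  assumes p: "0 < p" "p < 1"
  defines "q \<equiv> 1 - p"
  shows "3 / 2 + q ^ 3 + q ^ 3 / p < 3 * (1 + q ^ 3) / (2 * (1 - q ^ 3))"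
proof -
  have q: "0 < q" "q < 1" using p by (auto simp: q_def)
  have q3: "q ^ 3 < 1" using q by (simp add: power_less_one_iff)
  \<comment> \<open>This product is exactly 3 minus the left side of the inequality derived
    next.\<close>
  have "0 < (1 - q) * (1 - q\<^sup>2)"
    using q by (simp add: power_less_one_iff)
  then have "(2 - q) * (1 + q + q\<^sup>2) < 3"
    by (simp add: power2_eq_square power3_eq_cube algebra_simps)
  then have "(2 - q) * ((1 + q + q\<^sup>2) * (1 - q)) < 3 * (1 - q)"
    using mult_strict_right_mono[of "(2 - q) * (1 + q + q\<^sup>2)" 3 "1 - q"] q by (simp only: mult.assoc)
  moreover have "(1 + q + q\<^sup>2) * (1 - q) = 1 - q ^ 3"
    by (simp add: power2_eq_square power3_eq_cube algebra_simps)
  ultimately have "(2 - q) * (1 - q ^ 3) < 3 * (1 - q)" by simp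
  then have "(2 - q) / (1 - q) < 3 / (1 - q ^ 3)"
    using q q3 by (simp add: divide_simps)
  then have "q ^ 3 * ((2 - q) / (1 - q)) < q ^ 3 * (3 / (1 - q ^ 3))"
    using q by (intro mult_strict_left_mono) auto
  moreover have "q ^ 3 * ((2 - q) / (1 - q)) = q ^ 3 + q ^ 3 / p"
    using p by (simp add: q_def field_simps)
  moreover have "3 / 2 + q ^ 3 * (3 / (1 - q ^ 3)) = 3 * (1 + q ^ 3) / (2 * (1 - q ^ 3))"
    using q3 by (simp add: field_simps)
  ultimately show ?thesis by linarith
qed

text \<open>Cubing the hypothesis leaves only \<open>q ^ 3\<close>, which is at least 1/7. The
  values 1 to 7 then fail numerically; the closest is \<open>s = 7\<close>, where
  \<open>99 ^ 3 > 7 ^ 7\<close>.\<close>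

lemma ge_8_if_small_power:
  fixes q :: real and s :: nat
  assumes s: "0 < s" and h: "(2 * real s ^ 2 + 1) * q ^ s < 1" and q: "0 < q" "1 / 7 \<le> q ^ 3"
  shows "8 \<le> s"
proof (rule ccontr)
  assume "\<not> 8 \<le> s"
  then have cases: "s \<in> {1, 2, 3, 4, 5, 6, 7}" using s by auto
  have "((2 * real s ^ 2 + 1) * q ^ s) ^ 3 < 1"
    using h q by (intro power_less_one_iff[THEN iffD2]) auto
  then have "(2 * real s ^ 2 + 1) ^ 3 * (q ^ 3) ^ s < 1"
    by (simp add: power_mult_distrib mult.commute flip: power_mult)
  moreover have "(2 * real s ^ 2 + 1) ^ 3 * (1 / 7) ^ s \<le> (2 * real s ^ 2 + 1) ^ 3 * (q ^ 3) ^ s"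
    using q by (intro mult_left_mono power_mono) auto
  ultimately have "(2 * real s ^ 2 + 1) ^ 3 * (1 / 7) ^ s < 1" by linarith
  with cases show False by (auto simp: power_divide)
qed

text \<open>Below 2/p the power (1 - p)^s is still at least exp (-3), too large for the hypothesis.\<close>

lemma mult_ge_2_if_small_power:
  fixes p :: real and s :: nat
  assumes s: "8 \<le> s" and h: "(2 * real s ^ 2 + 1) * (1 - p) ^ s < 1" and p: "0 < p"
  shows "2 \<le> real s * p"
proof (rule ccontr)
  assume "\<not> 2 \<le> real s * p"
  then have sp: "real s * p < 2" by simp
  \<comment> \<open>The bound \<open>p < 1 / 4\<close> makes the logarithm estimate linear,
    \<open>ln (1 - p) \<ge> - (3 / 2) * p\<close>, so \<open>s * p < 2\<close> gives the exponent
    -3.\<close>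
  have "8 * p \<le> real s * p" using s p by (intro mult_right_mono) auto
  with sp have p4: "p < 1 / 4" by simp
  have "- p - 2 * p\<^sup>2 \<le> ln (1 - p)"
    using p p4 by (intro ln_one_minus_pos_lower_bound) auto
  moreover have "p\<^sup>2 \<le> p / 4" using p p4 by (simp add: power2_eq_square mult_left_le)
  ultimately have "- (3 / 2) * p \<le> ln (1 - p)" by simp
  then have "real s * (- (3 / 2) * p) \<le> real s * ln (1 - p)"
    by (intro mult_left_mono) auto
  with sp have "- 3 \<le> real s * ln (1 - p)" by simp
  then have "exp (- 3) \<le> exp (real s * ln (1 - p))" by simp
  also have "\<dots> = (1 - p) ^ s"
    using p4 by (simp add: exp_of_nat_mult)
  finally have e: "exp (- 3) \<le> (1 - p) ^ s" .
  have "exp 3 = exp (1::real) ^ 3" by (simp flip: exp_of_nat_mult)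
  also have "\<dots> \<le> 3 ^ 3" by (intro power_mono exp_le) auto
  finally have "exp (3::real) \<le> 27" by simp
  then have "1 / 27 \<le> exp (- 3 :: real)" by (simp add: exp_minus field_simps)
  with e have e': "1 / 27 \<le> (1 - p) ^ s" by linarith
  have "8 ^ 2 \<le> real s ^ 2" using s by (intro power_mono) auto
  then have "27 * (1 / 27) \<le> (2 * real s ^ 2 + 1) * (1 - p) ^ s"
    using e' by (intro mult_mono) auto
  with h show False by simp
qed

text \<open>In the second range of p already (s + 1)/2 is at least 1/2 + 1/p.\<close>

lemma cost_less_constant:
  fixes p :: real
  assumes p: "0 < p" "p < 1"
  defines "q \<equiv> 1 - p"
  defines "s \<equiv> (LEAST s::nat. 0 < s \<and> (2 * real s ^ 2 + 1) * q ^ s < 1)"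
  shows "3 / 2 + q ^ 3 + q ^ 3 / p < (if p > 1 - 1 / root 3 7
                 then 3 * (1 + q ^ 3) / (2 * (1 - q ^ 3))
                 else (real s + 1) / 2 + real s * q ^ s + real s * q ^ (2 * s) / (1 - q ^ s))"
proof (cases "p > 1 - 1 / root 3 7")
  case True
  then show ?thesis using triangle_star_cost_less[OF p] by (simp add: q_def)
next
  case False
  have q: "0 < q" "q < 1" using p by (auto simp: q_def)
  have "((\<lambda>s::nat. (2 * real s ^ 2 + 1) * q ^ s) \<longlongrightarrow> 0) sequentially"
    using q by real_asymp
  then have "eventually (\<lambda>s::nat. (2 * real s ^ 2 + 1) * q ^ s < 1) sequentially"
    by (rule order_tendstoD) simp
  \<comment> \<open>Existence is needed before the \<open>LEAST\<close> in \<open>s\<close> can be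
    used to obtain the defining inequality.\<close>
  then have "\<exists>s::nat. 0 < s \<and> (2 * real s ^ 2 + 1) * q ^ s < 1"
    using eventually_gt_at_top[of 0] eventually_conj eventually_happens'
    by (metis (mono_tags, lifting) sequentially_bot)
  from LeastI_ex[OF this] have s: "0 < s" "(2 * real s ^ 2 + 1) * q ^ s < 1"
    by (simp_all add: s_def)
  have "1 / root 3 7 \<le> q" using False by (simp add: q_def)
  then have "(1 / root 3 7) ^ 3 \<le> q ^ 3" by (intro power_mono) auto
  then have q3: "1 / 7 \<le> q ^ 3" by (simp add: power_divide)
  have "2 \<le> real s * p"
    using ge_8_if_small_power[OF s q(1) q3] s p by (intro mult_ge_2_if_small_power) (auto simp: q_def)
  then have "1 / p \<le> real s / 2" using p by (simp add: field_simps)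
  moreover have "q\<^sup>2 \<le> q"
    using q power_decreasing[of 1 2 q] by auto
  \<comment> \<open>Since \<open>1 / p - 1 = q / p\<close>, this amounts to
    \<open>q ^ 3 * (1 + p) \<le> q\<close>. The strict inequality of the lemma comes from the
    positive term \<open>s * q ^ s\<close>.\<close>
  moreover have "3 / 2 + q ^ 3 + q ^ 3 / p \<le> 1 / 2 + 1 / p"
  proof -
    have "q ^ 3 * (1 + p) \<le> q"
    proof -
      have "q\<^sup>2 * (1 + p) \<le> q * (1 + p)" using q p \<open>q\<^sup>2 \<le> q\<close> by (intro mult_right_mono) auto
      also have "\<dots> = 1 - p\<^sup>2" by (simp add: q_def power2_eq_square algebra_simps)
      also have "\<dots> \<le> 1" by simp
      finally have "q * (q\<^sup>2 * (1 + p)) \<le> q * 1" using q by (intro mult_left_mono) auto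
      then show ?thesis by (simp add: power3_eq_cube power2_eq_square mult.assoc)
    qed
    then have "q ^ 3 * (1 + p) / p \<le> q / p" using p by (intro divide_right_mono) auto
    moreover have "q ^ 3 * (1 + p) / p = q ^ 3 + q ^ 3 / p" using p by (simp add: field_simps)
    moreover have "q / p = 1 / p - 1" using p by (simp add: q_def field_simps)
    ultimately show ?thesis by linarith
  qed
  moreover have "0 < real s * q ^ s" using s q by simp
  moreover have "0 \<le> real s * q ^ (2 * s) / (1 - q ^ s)"
    using q by (simp add: power_le_one)
  ultimately show ?thesis using False by (simp add: add_divide_distrib)
qed

section \<open>Choice of parameters and passage to the limit\<close>

theorem theorem2:
  fixes p :: real
  assumes "0 < p" and "p < 1"
  defines "q \<equiv> 1 - p"
  defines "s \<equiv> (LEAST s::nat. 0 < s \<and> (2 * real s ^ 2 + 1) * q ^ s < 1)"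
  defines "c \<equiv> (if p > 1 - 1 / root 3 7
                 then 3 * (1 + q ^ 3) / (2 * (1 - q ^ 3))
                 else (real s + 1) / 2 + real s * q ^ s + real s * q ^ (2 * s) / (1 - q ^ s))"
  shows "\<exists>\<epsilon> :: nat \<Rightarrow> real. \<epsilon> \<longlonglongrightarrow> 0 \<and>
           (\<lambda>n. measure_pmf.prob (Gnp n p)
                  {G. real (sat_C4 G) \<le> c * real n * (1 + \<epsilon> n)}) \<longlonglongrightarrow> 1"
proof -
  note p = assms(1,2)
  define \<beta> where "\<beta> = p\<^sup>2 / 2"
  \<comment> \<open>The positive gap \<open>\<eta>\<close> is spent in three equal parts: on
    \<open>q ^ K / \<beta>\<close>, on the \<open>\<delta>\<close> terms, and on the quadratic term
    in the number of hubs.\<close>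
  define \<eta> where "\<eta> = c - (3 / 2 + q ^ 3 + q ^ 3 / p)"
  have "3 / 2 + q ^ 3 + q ^ 3 / p < c"
    using cost_less_constant[OF p] unfolding c_def s_def q_def .
  then have \<eta>: "\<eta> > 0" by (simp add: \<eta>_def)
  have q: "0 < q" "q < 1" using p by (auto simp: q_def)
  have "p\<^sup>2 \<le> 1" using p power_le_one[of p 2] by simp
  then have \<beta>: "0 < \<beta>" "\<beta> < 1" using p unfolding \<beta>_def by (simp, linarith)
  have "(\<lambda>K. q ^ K / \<beta>) \<longlonglongrightarrow> 0 / \<beta>"
    using q \<beta> by (intro tendsto_intros LIMSEQ_power_zero) auto
  then have "eventually (\<lambda>K. q ^ K / \<beta> < \<eta> / 3) sequentially"
    using \<eta> by (intro order_tendstoD) auto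
  then obtain K where K: "3 \<le> K" "q ^ K / \<beta> < \<eta> / 3"
    using eventually_ge_at_top[of 3] eventually_conj eventually_happens'
    by (metis (mono_tags, lifting) sequentially_bot)
  \<comment> \<open>The first bound is what the codegree estimate requires, the second keeps the
    \<open>\<delta>\<close> terms within a third of \<open>\<eta>\<close>.\<close>
  define \<delta> where "\<delta> = min (p\<^sup>2 / 6) (\<eta> / 3 / (real K + 1 + 1 / \<beta>))"
  have pos: "0 < real K + 1 + 1 / \<beta>" using \<beta> by (intro add_nonneg_pos) auto
  have \<delta>: "0 < \<delta>" "6 * \<delta> \<le> p\<^sup>2" using p \<eta> pos by (auto simp: \<delta>_def)
  have "\<delta> \<le> \<eta> / 3 / (real K + 1 + 1 / \<beta>)" by (simp add: \<delta>_def)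
  then have \<delta>\<eta>: "(real K + 1 + 1 / \<beta>) * \<delta> \<le> \<eta> / 3"
    using pos by (simp only: pos_le_divide_eq mult.commute)
  \<comment> \<open>The power \<open>n powr (1 / 4)\<close> is a convenient bound for the
    logarithmic number of greedy hubs: it outgrows the logarithm, yet its square is still of smaller
    order than \<open>n\<close>.\<close>
  have ev: "eventually (\<lambda>n. real K + 2 < p\<^sup>2 / 2 * real n \<and>
      (1 - \<beta>) powr (real n powr (1 / 4)) * real n < 1 - \<beta> \<and>
      2 * (real K + real n powr (1 / 4))\<^sup>2 \<le> \<eta> / 3 * real n) sequentially"
  proof (intro eventually_conj)
    show "eventually (\<lambda>n. real K + 2 < p\<^sup>2 / 2 * real n) sequentially"
      using p by real_asymp
    have "(\<lambda>n::nat. (1 - \<beta>) powr (real n powr (1 / 4)) * real n) \<longlonglongrightarrow> 0"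
      using \<beta> by real_asymp
    then show "eventually (\<lambda>n::nat. (1 - \<beta>) powr (real n powr (1 / 4)) * real n < 1 - \<beta>) sequentially"
      using \<beta> by (intro order_tendstoD) auto
    show "eventually (\<lambda>n::nat. 2 * (real K + real n powr (1 / 4))\<^sup>2 \<le> \<eta> / 3 * real n) sequentially"
      using \<eta> by real_asymp
  qed
  have good: "real (sat_C4 G) \<le> c * real n"
    if eq: "equidistributed n (1 - p) K \<delta> G"
      and n: "real K + 2 < p\<^sup>2 / 2 * real n" "(1 - \<beta>) powr (real n powr (1 / 4)) * real n < 1 - \<beta>"
        "2 * (real K + real n powr (1 / 4))\<^sup>2 \<le> \<eta> / 3 * real n"
    for n G
  proof -
    obtain l where l: "l = 0 \<or> 1 - \<beta> \<le> (1 - \<beta>) ^ l * real n"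
      "real (sat_C4 G) \<le> (3 / 2 + q ^ 3 + q ^ 3 / p + q ^ K / \<beta> + (real K + 1 + 1 / \<beta>) * \<delta>) * real n
       + 2 * (real K + real l)\<^sup>2"
      using sat_C4_le_of_equidistributed[OF eq K(1) \<delta>(2) _ p n(1)] \<delta>(1)
      unfolding \<beta>_def q_def by auto
    have "real l \<le> real n powr (1 / 4)"
    proof (rule ccontr)
      assume "\<not> ?thesis"
      then have gt: "real n powr (1 / 4) < real l" by simp
      then have "1 - \<beta> \<le> (1 - \<beta>) ^ l * real n" using l(1) by (auto simp: not_less[symmetric])
      also have "(1 - \<beta>) ^ l = (1 - \<beta>) powr real l" using \<beta> by (simp add: powr_realpow)
      also have "\<dots> * real n \<le> (1 - \<beta>) powr (real n powr (1 / 4)) * real n"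
        using gt \<beta> by (intro mult_right_mono) (auto simp: powr_mono')
      finally show False using n(2) by simp
    qed
    then have "2 * (real K + real l)\<^sup>2 \<le> 2 * (real K + real n powr (1 / 4))\<^sup>2"
      by (intro mult_left_mono power_mono) auto
    also note n(3)
    finally have 1: "2 * (real K + real l)\<^sup>2 \<le> \<eta> / 3 * real n" .
    have "c = 3 / 2 + q ^ 3 + q ^ 3 / p + \<eta>" by (simp add: \<eta>_def)
    then have "3 / 2 + q ^ 3 + q ^ 3 / p + q ^ K / \<beta> + (real K + 1 + 1 / \<beta>) * \<delta> \<le> c - \<eta> / 3"
      using K(2) \<delta>\<eta> by linarith
    then have "(3 / 2 + q ^ 3 + q ^ 3 / p + q ^ K / \<beta> + (real K + 1 + 1 / \<beta>) * \<delta>) * real n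
        \<le> (c - \<eta> / 3) * real n"
      by (rule mult_right_mono) simp
    with 1 l(2) show ?thesis by (simp add: algebra_simps)
  qed
  have "(\<lambda>n. measure_pmf.prob (Gnp n p) {G. real (sat_C4 G) \<le> c * real n}) \<longlonglongrightarrow> 1"
  proof (rule tendsto_sandwich)
    show "(\<lambda>n. measure_pmf.prob (Gnp n p) {G. equidistributed n (1 - p) K \<delta> G}) \<longlonglongrightarrow> 1"
      using p \<delta> by (intro Gnp_equidistributed_tendsto_1) auto
    show "eventually (\<lambda>n. measure_pmf.prob (Gnp n p) {G. equidistributed n (1 - p) K \<delta> G}
        \<le> measure_pmf.prob (Gnp n p) {G. real (sat_C4 G) \<le> c * real n}) sequentially"
      using ev
    proof eventually_elim
      case (elim n)
      then show ?case by (intro measure_pmf.finite_measure_mono) (auto intro: good)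
    qed
    show "eventually (\<lambda>n. measure_pmf.prob (Gnp n p) {G. real (sat_C4 G) \<le> c * real n} \<le> 1) sequentially"
      by simp
  qed simp
  \<comment> \<open>The gap has absorbed all error terms, so the zero function serves as
    \<open>\<epsilon>\<close>.\<close>
  then show ?thesis by (intro exI[of _ "\<lambda>_. 0"]) simp
qed

end
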